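(* For every dimension $n\geq 1$, the inverse circumradius process of the convex hull of standard Brownian motion in $\mathbb{R}^n$ satisfies \[ \frac{1}{\log 2}\,\frac{1}{n}\;\leq\;\mathbb{E}\left[\Theta^R_1\right]\;\leq\; 4\,\frac{1}{n}. \]
   Context: Let $\boldsymbol{W}=\{\boldsymbol{W}_t:t\geq 0\}$ be standard Brownian motion in $\mathbb{R}^n$ started at the origin, i.e. $\boldsymbol{W}_t=(W_t^{(1)},\dots,W_t^{(n)})$ where the coordinates are independent standard one-dimensional Brownian motions. Let $\mathcal{H}_t:=\operatorname{conv}\{\boldsymbol{W}_s:0\leq s\leq t\}$ be the convex hull of the path up to time $t$ (almost surely a nonempty compact convex set). Let $R_t:=R(\mathcal{H}_t)$, where $R(\mathcal{K})$ denotes the circumradius of $\mathcal{K}$, i.e. the radius of the smallest closed Euclidean ball containing $\mathcal{K}$. The inverse circumradius process is $\Theta_y^R:=\inf\{t\geq 0: R_t>y\}$ for $y\geq 0$. $\log$ is the natural logarithm. *)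

theory Defs
  imports "HOL-Probability.Probability"
begin

text \<open>Processes are indexed by \<^typ>\<open>real\<close>; only the values at times \<open>t \<ge> 0\<close> matter. The starting
  point and the continuity of paths are required almost surely.\<close>

definition standard_brownian_motion_1d :: "'w measure \<Rightarrow> (real \<Rightarrow> 'w \<Rightarrow> real) \<Rightarrow> bool" where
  "standard_brownian_motion_1d M B \<longleftrightarrow>
     prob_space M \<and>
     (\<forall>t\<ge>0. B t \<in> borel_measurable M) \<and>
     (AE \<omega> in M. B 0 \<omega> = 0) \<and>
     (\<forall>s t. 0 \<le> s \<longrightarrow> s < t \<longrightarrow>
        distributed M lborel (\<lambda>\<omega>. B t \<omega> - B s \<omega>) (normal_density 0 (sqrt (t - s)))) \<and>
     (\<forall>(k::nat) (\<tau>::nat \<Rightarrow> real). 0 \<le> \<tau> 0 \<longrightarrow> (\<forall>i<k. \<tau> i < \<tau> (Suc i)) \<longrightarrow>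
        prob_space.indep_vars M (\<lambda>_. borel) (\<lambda>i \<omega>. B (\<tau> (Suc i)) \<omega> - B (\<tau> i) \<omega>) {..<k}) \<and>
     (AE \<omega> in M. continuous_on {0..} (\<lambda>t. B t \<omega>))"

text \<open>The coordinates are independent as processes, i.e. as random elements of the product space
  of all functions \<open>[0, \<infinity>) \<rightarrow> \<real>\<close>.\<close>

definition standard_brownian_motion :: "'w measure \<Rightarrow> (real \<Rightarrow> 'w \<Rightarrow> real ^ 'n) \<Rightarrow> bool" where
  "standard_brownian_motion M W \<longleftrightarrow>
     prob_space M \<and>
     (\<forall>i. standard_brownian_motion_1d M (\<lambda>t \<omega>. W t \<omega> $ i)) \<and>
     prob_space.indep_vars M (\<lambda>_. Pi\<^sub>M {0..} (\<lambda>_. borel))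
       (\<lambda>i \<omega>. \<lambda>t\<in>{0..}. W t \<omega> $ i) UNIV"

definition path_hull :: "(real \<Rightarrow> 'w \<Rightarrow> real ^ 'n) \<Rightarrow> real \<Rightarrow> 'w \<Rightarrow> (real ^ 'n) set" where
  "path_hull W t \<omega> = convex hull ((\<lambda>s. W s \<omega>) ` {0..t})"

definition circumradius :: "(real ^ 'n) set \<Rightarrow> real" where
  "circumradius K = Inf {r. 0 \<le> r \<and> (\<exists>c. K \<subseteq> cball c r)}"

text \<open>The infimum is a minimum, so \<^const>\<open>circumradius\<close> is indeed the radius of a smallest
  enclosing closed ball.\<close>

lemma circumradius_attained:
  fixes K :: "(real ^ 'n) set"
  assumes "bounded K" "K \<noteq> {}"
  shows "0 \<le> circumradius K" "\<exists>c. K \<subseteq> cball c (circumradius K)"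
    "\<And>c r. K \<subseteq> cball c r \<Longrightarrow> circumradius K \<le> r"
proof -
  define S where "S = {r. 0 \<le> r \<and> (\<exists>c. K \<subseteq> cball c r)}"
  obtain x0 where x0: "x0 \<in> K" using assms(2) by blast
  obtain R where R: "K \<subseteq> cball x0 R"
    using assms(1) by (auto simp: bounded_any_center[where a = x0] subset_iff)
  have R0: "0 \<le> R" using R x0 by auto
  define T where "T = (\<Inter>x\<in>K. {p::(real^'n) \<times> real. dist (fst p) x \<le> snd p}) \<inter> (cball x0 R \<times> {0..R})"
  have "compact T" unfolding T_def
    by (intro closed_Int_compact closed_INT ballI closed_Collect_le compact_Times compact_cball
        compact_Icc continuous_intros)
  moreover have "(x0, R) \<in> T" using R R0 unfolding T_def by (auto simp: dist_commute)
  ultimately obtain p where p: "p \<in> T" and pmin: "\<And>q. q \<in> T \<Longrightarrow> snd p \<le> snd q"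
    using continuous_attains_inf[of T snd] continuous_on_snd[OF continuous_on_id] by (metis empty_iff)
  have pS: "snd p \<in> S" "K \<subseteq> cball (fst p) (snd p)"
    using p unfolding T_def S_def by (auto simp: subset_iff)
  have least: "snd p \<le> r" if "K \<subseteq> cball c r" for c r
  proof (cases "r \<le> R")
    case True
    have "x0 \<in> cball c r" using that x0 by blast
    then have "0 \<le> r" "dist c x0 \<le> R" using True by (auto intro: order_trans[OF zero_le_dist])
    then have "(c, r) \<in> T" using that True unfolding T_def by (auto simp: dist_commute)
    then show ?thesis using pmin by force
  next
    case False
    then show ?thesis using p unfolding T_def by auto
  qed
  have "circumradius K = snd p"
    unfolding circumradius_def S_def[symmetric]
    by (rule cInf_eq_minimum) (use pS least in \<open>auto simp: S_def\<close>)
  then show "0 \<le> circumradius K" "\<exists>c. K \<subseteq> cball c (circumradius K)"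
    "\<And>c r. K \<subseteq> cball c r \<Longrightarrow> circumradius K \<le> r"
    using pS least unfolding S_def by auto
qed

text \<open>Values in \<open>[0, \<infinity>]\<close>, so that the infimum of the empty set is \<open>\<infinity>\<close>.\<close>

definition inverse_circumradius :: "(real \<Rightarrow> 'w \<Rightarrow> real ^ 'n) \<Rightarrow> real \<Rightarrow> 'w \<Rightarrow> ennreal" where
  "inverse_circumradius W y \<omega> = (INF t\<in>{t. 0 \<le> t \<and> circumradius (path_hull W t \<omega>) > y}. ennreal t)"

end

theory Submission
  imports Defs
begin

text \<open>Both bounds come from optional stopping for squared distances, in dimension \<open>n\<close>: the mean of
  \<open>\<parallel>W t - c\<parallel>\<^sup>2\<close> grows at rate \<open>n\<close> as long as the center \<open>c\<close> is kept fixed.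

  Upper bound: when the path is farther than \<open>2\<close> from its starting point, the hull has circumradius
  above \<open>1\<close>. The mean exit time from the ball of radius \<open>2\<close> is \<open>4 / n\<close>.

  Lower bound: a ball \<open>B(c, r)\<close> containing the path so far is maintained adaptively; when the path
  leaves it, it is replaced by the smallest ball containing it and the new position. The potential
  \<open>r\<^sup>2 + \<parallel>W t - c\<parallel>\<^sup>2\<close> is not increased by such a replacement (\<open>enlarge_potential\<close>), and otherwise its
  mean grows at rate \<open>n\<close>. At the first time when \<open>r > 1\<close> the position is on the sphere, so the potential
  is above \<open>2\<close>; until then the hull has circumradius at most \<open>1\<close>. Hence the mean of the inverse
  circumradius at \<open>1\<close> is at least \<open>2 / n\<close>, which is more than \<open>1 / (n ln 2)\<close>. In dimension one
  \<open>2 / n\<close> is the exact value.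

  The argument is carried out for the path sampled on a time grid, where a stopping time is replaced by
  the events that the walk has not been stopped yet (\<open>stopped_sum_expectation\<close>) and the position may jump
  across a sphere. For the lower bound such a jump is favourable (\<open>greedy_stopped_sum\<close>); for the upper
  bound it is controlled by fourth moments (\<open>exit_stopped_sum\<close>). Refining the grid transfers the two
  estimates to the continuous path: the sampled exit from the ball of radius \<open>2\<close> comes after the
  inverse circumradius on every grid, and the greedy radius exceeds \<open>1\<close> in time by uniform continuity
  (\<open>limsup_greedy_le_inverse_circumradius\<close>).\<close>

section \<open>A greedy enclosing ball\<close>

text \<open>A ball is encoded as the pair of its center and its radius. When \<open>p\<close> lies outside, the new ball is
  the smallest ball containing both the old one and \<open>p\<close>: its diameter runs from \<open>p\<close> through the old
  center to the opposite point of the old sphere.\<close>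

definition enlarge :: "'a::real_inner \<times> real \<Rightarrow> 'a \<Rightarrow> 'a \<times> real" where
  "enlarge B p = (let c = fst B; r = snd B; d = dist p c in
     if d \<le> r then B else (c + ((d - r) / (2 * d)) *\<^sub>R (p - c), (r + d) / 2))"

lemma enlarge_outside:
  assumes "0 \<le> r" "r < dist p c"
  shows "snd (enlarge (c, r) p) = (r + dist p c) / 2"
    and "dist c (fst (enlarge (c, r) p)) = (dist p c - r) / 2"
    and "dist p (fst (enlarge (c, r) p)) = (r + dist p c) / 2"
proof -
  define d where "d = dist p c"
  define a where "a = (d - r) / (2 * d)"
  have d: "0 < d" "r < d" "norm (p - c) = d" using assms by (auto simp: d_def dist_norm)
  have ad: "a * d = (d - r) / 2" "(1 - a) * d = (r + d) / 2"
    using d by (simp_all add: a_def field_simps)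
  have a: "0 \<le> a" "a \<le> 1" using d assms(1) by (simp_all add: a_def field_simps)
  have e: "enlarge (c, r) p = (c + a *\<^sub>R (p - c), (r + d) / 2)"
    using d by (simp add: enlarge_def d_def a_def Let_def)
  show "snd (enlarge (c, r) p) = (r + dist p c) / 2" by (simp add: e d_def)
  show "dist c (fst (enlarge (c, r) p)) = (dist p c - r) / 2"
    using ad(1) a(1) d by (simp add: e dist_norm flip: d_def)
  have "p - (c + a *\<^sub>R (p - c)) = (1 - a) *\<^sub>R (p - c)" by (simp add: algebra_simps)
  then show "dist p (fst (enlarge (c, r) p)) = (r + dist p c) / 2"
    using ad(2) a(2) d by (simp add: e dist_norm flip: d_def)
qed

lemma enlarge_contains:
  assumes "0 \<le> r"
  shows "cball c r \<subseteq> cball (fst (enlarge (c, r) p)) (snd (enlarge (c, r) p))"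
    and "dist p (fst (enlarge (c, r) p)) \<le> snd (enlarge (c, r) p)"
    and "r \<le> snd (enlarge (c, r) p)"
proof -
  let ?c = "fst (enlarge (c, r) p)" and ?r = "snd (enlarge (c, r) p)"
  have "dist c ?c \<le> ?r - r \<and> dist p ?c \<le> ?r"
  proof (cases "dist p c \<le> r")
    case True then show ?thesis by (simp add: enlarge_def)
  next
    case False
    then show ?thesis using enlarge_outside[of r p c] assms by (simp add: field_simps)
  qed
  then have *: "dist c ?c \<le> ?r - r" "dist p ?c \<le> ?r" by auto
  show "dist p ?c \<le> ?r" by fact
  show "r \<le> ?r" using *(1) zero_le_dist[of c ?c] by linarith
  show "cball c r \<subseteq> cball ?c ?r"
  proof
    fix x assume "x \<in> cball c r"
    then show "x \<in> cball ?c ?r"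
      using *(1) dist_triangle[of ?c x c] by (simp add: dist_commute)
  qed
qed

text \<open>This is what makes the choice of the smallest new ball the right one. The potential of a ball
  together with a point is radius squared plus squared distance from the center to the point. If the
  point lies outside, the old potential is \<open>r\<^sup>2 + d\<^sup>2\<close> and the new one, with the point on the new
  sphere, is \<open>2 ((r + d) / 2)\<^sup>2\<close>; so recentring never increases it, however far the point has
  jumped.\<close>

lemma enlarge_potential:
  assumes "0 \<le> r"
  shows "(snd (enlarge (c, r) p))\<^sup>2 + (dist p (fst (enlarge (c, r) p)))\<^sup>2 \<le> r\<^sup>2 + (dist p c)\<^sup>2"
proof (cases "dist p c \<le> r")
  case True then show ?thesis by (simp add: enlarge_def)
next
  case False
  have "2 * ((r + dist p c) / 2)\<^sup>2 \<le> r\<^sup>2 + (dist p c)\<^sup>2"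
    using zero_le_power2[of "r - dist p c"] by (simp add: power2_eq_square algebra_simps)
  moreover have "snd (enlarge (c, r) p) = (r + dist p c) / 2"
    "dist p (fst (enlarge (c, r) p)) = (r + dist p c) / 2"
    using enlarge_outside[of r p c] False assms by simp_all
  ultimately show ?thesis by (simp only: mult_2)
qed

primrec greedy_ball :: "(nat \<Rightarrow> 'a::real_inner) \<Rightarrow> nat \<Rightarrow> 'a \<times> real" where
  "greedy_ball Y 0 = (Y 0, 0)"
| "greedy_ball Y (Suc j) = enlarge (greedy_ball Y j) (Y (Suc j))"

abbreviation "greedy_center Y j \<equiv> fst (greedy_ball Y j)"
abbreviation "greedy_radius Y j \<equiv> snd (greedy_ball Y j)"

lemma greedy_ball_cong:
  "(\<And>i. i \<le> j \<Longrightarrow> Y i = Y' i) \<Longrightarrow> greedy_ball Y j = greedy_ball Y' j"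
  by (induction j) auto

lemma greedy_radius_nonneg: "0 \<le> greedy_radius Y j"
proof (induction j)
  case (Suc j)
  then show ?case
    using enlarge_contains(3)[of "greedy_radius Y j" "greedy_center Y j" "Y (Suc j)"] by simp
qed simp

lemma greedy_radius_Suc: "greedy_radius Y j \<le> greedy_radius Y (Suc j)"
  using enlarge_contains(3)[OF greedy_radius_nonneg[of Y j], of "greedy_center Y j" "Y (Suc j)"] by simp

lemma greedy_radius_mono: "i \<le> j \<Longrightarrow> greedy_radius Y i \<le> greedy_radius Y j"
  using lift_Suc_mono_le[of "greedy_radius Y"] greedy_radius_Suc by blast

lemma greedy_ball_covers: "i \<le> j \<Longrightarrow> Y i \<in> cball (greedy_center Y j) (greedy_radius Y j)"
proof (induction j)
  case (Suc j)
  show ?case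
  proof (cases "i = Suc j")
    case True
    then show ?thesis
      using enlarge_contains(2)[OF greedy_radius_nonneg[of Y j], of "Y (Suc j)" "greedy_center Y j"]
      by (simp add: dist_commute)
  next
    case False
    then show ?thesis
      using Suc enlarge_contains(1)[OF greedy_radius_nonneg[of Y j], of "greedy_center Y j" "Y (Suc j)"]
      by (auto simp del: mem_cball)
  qed
qed simp

lemma greedy_potential_Suc:
  "(greedy_radius Y (Suc j))\<^sup>2 + (dist (Y (Suc j)) (greedy_center Y (Suc j)))\<^sup>2
   \<le> (greedy_radius Y j)\<^sup>2 + (dist (Y (Suc j)) (greedy_center Y j))\<^sup>2"
  using enlarge_potential[OF greedy_radius_nonneg[of Y j], of "greedy_center Y j" "Y (Suc j)"] by simp

text \<open>The radius only grows at times when the ball was enlarged to reach the new point.\<close>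

lemma greedy_boundary:
  assumes "greedy_radius Y j < greedy_radius Y (Suc j)"
  shows "dist (Y (Suc j)) (greedy_center Y (Suc j)) = greedy_radius Y (Suc j)"
proof (cases "dist (Y (Suc j)) (greedy_center Y j) \<le> greedy_radius Y j")
  case True then show ?thesis using assms by (simp add: enlarge_def)
next
  case False
  then show ?thesis
    using enlarge_outside[OF greedy_radius_nonneg[of Y j], of "Y (Suc j)" "greedy_center Y j"] by simp
qed

definition walk :: "(nat \<Rightarrow> 'a::real_inner) \<Rightarrow> nat \<Rightarrow> 'a" where
  "walk d j = (\<Sum>l<j. d l)"

lemma walk_simps [simp]: "walk d 0 = 0" "walk d (Suc j) = walk d j + d j"
  by (simp_all add: walk_def)

lemma walk_restrict: "i \<le> j \<Longrightarrow> walk (restrict d {..<j}) i = walk d i"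
  unfolding walk_def by (rule sum.cong) auto

lemma dist_add_square:
  "(dist (x + y) c)\<^sup>2 = (dist x c)\<^sup>2 + (2 * (y \<bullet> (x - c)) + (norm y)\<^sup>2)" for x y c :: "'a::real_inner"
  unfolding dist_norm power2_norm_eq_inner by (simp add: algebra_simps inner_commute)

text \<open>As long as the radius is at most \<open>1\<close>, the summand with index \<open>j\<close> is the change of
  \<open>(dist (walk d j) (c j))\<^sup>2\<close> caused by the next step with the center held fixed, and recentring does not
  increase the potential. So the partial sums dominate the potential up to and including the first
  time when the radius exceeds \<open>1\<close>. At that time the point lies on the sphere and the potential is
  twice the squared radius: this is the source of the factor \<open>2\<close>. An overshoot only helps.\<close>

lemma greedy_stopped_sum:
  fixes d :: "nat \<Rightarrow> 'a::real_inner"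
  defines "r \<equiv> greedy_radius (walk d)" and "c \<equiv> greedy_center (walk d)"
  shows "2 * of_bool (\<not> r k \<le> 1)
    \<le> (\<Sum>j<k. of_bool (r j \<le> 1) * (2 * (d j \<bullet> (walk d j - c j)) + (norm (d j))\<^sup>2))"
proof -
  define S where "S k = (\<Sum>j<k. of_bool (r j \<le> 1) * (2 * (d j \<bullet> (walk d j - c j)) + (norm (d j))\<^sup>2))" for k
  have S_Suc: "S (Suc k) = S k + of_bool (r k \<le> 1) * (2 * (d k \<bullet> (walk d k - c k)) + (norm (d k))\<^sup>2)" for k
    by (simp add: S_def)
  have "if r k \<le> 1 then (r k)\<^sup>2 + (dist (walk d k) (c k))\<^sup>2 \<le> S k else 2 \<le> S k" for k
  proof (induction k)
    case 0 then show ?case by (simp add: S_def r_def c_def)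
  next
    case (Suc k)
    show ?case
    proof (cases "r k \<le> 1")
      case False
      then have "\<not> r (Suc k) \<le> 1" using greedy_radius_Suc[of "walk d" k] by (simp add: r_def)
      then show ?thesis using False Suc by (simp add: S_Suc)
    next
      case True
      have "(r (Suc k))\<^sup>2 + (dist (walk d (Suc k)) (c (Suc k)))\<^sup>2
          \<le> (r k)\<^sup>2 + (dist (walk d k + d k) (c k))\<^sup>2"
        using greedy_potential_Suc[of "walk d" k] by (simp add: r_def c_def del: greedy_ball.simps)
      also have "\<dots> \<le> S (Suc k)" using Suc True by (simp add: S_Suc dist_add_square)
      finally have le: "(r (Suc k))\<^sup>2 + (dist (walk d (Suc k)) (c (Suc k)))\<^sup>2 \<le> S (Suc k)" .
      show ?thesis
      proof (cases "r (Suc k) \<le> 1")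
        case out: False
        then have "dist (walk d (Suc k)) (c (Suc k)) = r (Suc k)"
          using greedy_boundary[of "walk d" k] True unfolding r_def c_def by linarith
        moreover have "1 \<le> (r (Suc k))\<^sup>2" using out by (simp add: one_le_power)
        ultimately have "2 \<le> S (Suc k)" using le by simp
        then show ?thesis using out by simp
      qed (use le in simp)
    qed
  qed
  from this[of k] have "2 * of_bool (\<not> r k \<le> 1) \<le> S k"
    by (auto split: if_splits intro: order_trans[rotated])
  then show ?thesis by (simp add: S_def)
qed

text \<open>Up to the first exit from the ball of radius \<open>2\<close> the sum telescopes to the squared norm of the walk.
  At the exit the norm is at most \<open>2 + x\<close>, where \<open>x\<close> is the length of the last step. That step depends on
  the exit time, so the excess \<open>4 x + x\<^sup>2\<close> is bounded by a small constant plus a multiple of \<open>x ^ 4\<close>,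
  and \<open>x ^ 4\<close> by the sum over all steps: in the scaling limit the total fourth moment vanishes.\<close>

lemma exit_stopped_sum:
  fixes d :: "nat \<Rightarrow> 'a::real_inner"
  assumes \<delta>: "0 < \<delta>" "\<delta> \<le> 1"
  shows "(\<Sum>j<k. of_bool (\<forall>i\<le>j. norm (walk d i) \<le> 2) * (2 * (d j \<bullet> walk d j) + (norm (d j))\<^sup>2))
    \<le> 4 + 5 * \<delta> + 5 / \<delta> ^ 3 * (\<Sum>j<k. norm (d j) ^ 4)"
proof -
  define a where "a j = (\<forall>i\<le>j. norm (walk d i) \<le> 2)" for j
  define S where "S k = (\<Sum>j<k. of_bool (a j) * (2 * (d j \<bullet> walk d j) + (norm (d j))\<^sup>2))" for k
  define Z where "Z k = (\<Sum>j<k. norm (d j) ^ 4)" for k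
  have S_Suc: "S (Suc k) = S k + of_bool (a k) * (2 * (d k \<bullet> walk d k) + (norm (d k))\<^sup>2)" for k
    by (simp add: S_def)
  have Z_Suc: "Z (Suc k) = Z k + norm (d k) ^ 4" for k by (simp add: Z_def)
  have Z0: "0 \<le> Z k" for k by (simp add: Z_def sum_nonneg)
  have overshoot: "4 * x + x\<^sup>2 \<le> 5 * \<delta> + 5 / \<delta> ^ 3 * x ^ 4" if "0 \<le> x" for x
  proof (cases "x \<le> \<delta>")
    case True
    have "x\<^sup>2 \<le> \<delta> * 1" unfolding power2_eq_square using True that \<delta> by (intro mult_mono) auto
    moreover have "0 \<le> 5 / \<delta> ^ 3 * x ^ 4" using that \<delta> by simp
    ultimately show ?thesis using True by linarith
  next
    case False
    have "\<delta> ^ 3 * x \<le> x ^ 3 * x" using False \<delta> by (intro mult_right_mono power_mono) auto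
    then have 1: "x \<le> x ^ 4 / \<delta> ^ 3" using \<delta> by (simp add: field_simps power_numeral_reduce)
    have "\<delta> ^ 3 \<le> \<delta> ^ 2" using \<delta> by (intro power_decreasing) auto
    also have "\<dots> \<le> x ^ 2" using False \<delta> by (intro power_mono) auto
    finally have "\<delta> ^ 3 * x ^ 2 \<le> x ^ 2 * x ^ 2" by (intro mult_right_mono) auto
    then have 2: "x\<^sup>2 \<le> x ^ 4 / \<delta> ^ 3" using \<delta> by (simp add: field_simps power_numeral_reduce)
    have "5 / \<delta> ^ 3 * x ^ 4 = 5 * (x ^ 4 / \<delta> ^ 3)" by simp
    then show ?thesis using 1 2 \<delta> by linarith
  qed
  have "if a k then S k = (norm (walk d k))\<^sup>2 else S k \<le> 4 + 5 * \<delta> + 5 / \<delta> ^ 3 * Z k" for k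
  proof (induction k)
    case 0 then show ?case by (simp add: S_def a_def)
  next
    case (Suc k)
    show ?case
    proof (cases "a k")
      case False
      then have "\<not> a (Suc k)" using le_SucI unfolding a_def by blast
      moreover have "5 / \<delta> ^ 3 * Z k \<le> 5 / \<delta> ^ 3 * Z (Suc k)"
        using \<delta> by (intro mult_left_mono) (auto simp: Z_Suc)
      ultimately show ?thesis using False Suc by (simp add: S_Suc)
    next
      case True
      have eq: "S (Suc k) = (norm (walk d (Suc k)))\<^sup>2"
        using True Suc dist_add_square[of "walk d k" "d k" 0] by (simp add: S_Suc)
      have "norm (walk d k) \<le> 2" using True by (simp add: a_def)
      then have "norm (walk d (Suc k)) \<le> 2 + norm (d k)"
        using norm_triangle_ineq[of "walk d k" "d k"] by simp
      then have "S (Suc k) \<le> (2 + norm (d k))\<^sup>2" unfolding eq by (intro power_mono) auto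
      also have "\<dots> = 4 + (4 * norm (d k) + (norm (d k))\<^sup>2)" by (simp add: power2_eq_square algebra_simps)
      also have "\<dots> \<le> 4 + (5 * \<delta> + 5 / \<delta> ^ 3 * norm (d k) ^ 4)"
        using overshoot[of "norm (d k)"] by simp
      also have "5 / \<delta> ^ 3 * norm (d k) ^ 4 \<le> 5 / \<delta> ^ 3 * Z (Suc k)"
        using \<delta> Z0 by (intro mult_left_mono) (auto simp: Z_Suc)
      finally show ?thesis using eq by simp
    qed
  qed
  from this[of k] have "S k \<le> 4 + 5 * \<delta> + 5 / \<delta> ^ 3 * Z k"
  proof (cases "a k")
    case True
    then have "(norm (walk d k))\<^sup>2 \<le> 2\<^sup>2" by (intro power_mono) (auto simp: a_def)
    moreover have "0 \<le> 5 / \<delta> ^ 3 * Z k" using \<delta> Z0 by simp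
    ultimately show ?thesis using True \<open>if a k then _ else _\<close> \<delta> by simp
  qed simp
  then show ?thesis by (simp add: S_def Z_def a_def)
qed

section \<open>Stopped sums of independent centred steps\<close>

lemma le_one_plus_square: "y \<le> 1 + y\<^sup>2" for y :: real
proof -
  have "2 * y \<le> 1 + y\<^sup>2"
    using zero_le_power2[of "y - 1"] by (simp add: power2_eq_square algebra_simps)
  then show ?thesis using zero_le_power2[of y] by linarith
qed

lemma enlarge_measurable:
  fixes c p :: "'b \<Rightarrow> 'a::euclidean_space"
  assumes [measurable]: "c \<in> borel_measurable N" "r \<in> borel_measurable N" "p \<in> borel_measurable N"
  shows "(\<lambda>x. fst (enlarge (c x, r x) (p x))) \<in> borel_measurable N
    \<and> (\<lambda>x. snd (enlarge (c x, r x) (p x))) \<in> borel_measurable N"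
proof -
  have "(\<lambda>x. fst (enlarge (c x, r x) (p x))) = (\<lambda>x. if dist (p x) (c x) \<le> r x then c x
      else c x + ((dist (p x) (c x) - r x) / (2 * dist (p x) (c x))) *\<^sub>R (p x - c x))"
    "(\<lambda>x. snd (enlarge (c x, r x) (p x))) = (\<lambda>x. if dist (p x) (c x) \<le> r x then r x
      else (r x + dist (p x) (c x)) / 2)"
    by (auto simp: enlarge_def Let_def fun_eq_iff)
  then show ?thesis by simp
qed

text \<open>The features of Brownian increments on a time grid that the two exit estimates rely on: \<open>k\<close>
  independent centred steps with common second moment \<open>v\<close> and fourth moments at most \<open>q\<close>.\<close>

locale centred_steps = prob_space M for M :: "'w measure" +
  fixes D :: "nat \<Rightarrow> 'w \<Rightarrow> 'a::euclidean_space" and k :: nat and v q :: real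
  assumes indep: "indep_vars (\<lambda>_. borel) D {..<k}"
    and centred: "\<And>j. j < k \<Longrightarrow> expectation (D j) = 0"
    and square: "\<And>j. j < k \<Longrightarrow> expectation (\<lambda>\<omega>. (norm (D j \<omega>))\<^sup>2) = v"
    and fourth_integrable: "\<And>j. j < k \<Longrightarrow> integrable M (\<lambda>\<omega>. norm (D j \<omega>) ^ 4)"
    and fourth: "\<And>j. j < k \<Longrightarrow> expectation (\<lambda>\<omega>. norm (D j \<omega>) ^ 4) \<le> q"
begin

lemma D_measurable [measurable]: "j < k \<Longrightarrow> D j \<in> borel_measurable M"
  using indep by (auto simp: indep_vars_def)

lemma square_integrable: "j < k \<Longrightarrow> integrable M (\<lambda>\<omega>. (norm (D j \<omega>))\<^sup>2)"
proof (rule Bochner_Integration.integrable_bound[where f = "\<lambda>\<omega>. 1 + norm (D j \<omega>) ^ 4"])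
  from le_one_plus_square[of "(norm (D j \<omega>))\<^sup>2" for \<omega>]
  show "AE \<omega> in M. norm ((norm (D j \<omega>))\<^sup>2) \<le> norm (1 + norm (D j \<omega>) ^ 4)" by simp
qed (use fourth_integrable in \<open>auto intro!: Bochner_Integration.integrable_add\<close>)

lemma D_integrable: "j < k \<Longrightarrow> integrable M (D j)"
proof (rule Bochner_Integration.integrable_bound[where f = "\<lambda>\<omega>. 1 + (norm (D j \<omega>))\<^sup>2"])
  from le_one_plus_square[of "norm (D j \<omega>)" for \<omega>]
  show "AE \<omega> in M. norm (D j \<omega>) \<le> norm (1 + (norm (D j \<omega>))\<^sup>2)" by simp
qed (use square_integrable in \<open>auto intro!: Bochner_Integration.integrable_add\<close>)

text \<open>The martingale property behind both estimates: the weight \<open>u\<close> and the vector \<open>f\<close> are functions of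
  the earlier steps only, hence independent of the step \<open>D j\<close>; the cross term vanishes in every
  coordinate, and the squared norm contributes its mean \<open>v\<close>. Boundedness of \<open>u f\<close> gives
  integrability.\<close>

lemma predictable_step:
  fixes u :: "(nat \<Rightarrow> 'a) \<Rightarrow> real" and f :: "(nat \<Rightarrow> 'a) \<Rightarrow> 'a"
  assumes j: "j < k"
    and u: "u \<in> borel_measurable (PiM {..<j} (\<lambda>_. borel))" "\<And>x. \<bar>u x\<bar> \<le> 1"
    and f: "f \<in> borel_measurable (PiM {..<j} (\<lambda>_. borel))" "\<And>x. norm (u x *\<^sub>R f x) \<le> b"
  defines "past \<equiv> \<lambda>\<omega>. restrict (\<lambda>i. D i \<omega>) {..<j}"
  defines "g \<equiv> \<lambda>\<omega>. u (past \<omega>) * (2 * (D j \<omega> \<bullet> f (past \<omega>)) + (norm (D j \<omega>))\<^sup>2)"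
  shows "integrable M g" "expectation g = v * expectation (\<lambda>\<omega>. u (past \<omega>))"
proof -
  have past [measurable]: "past \<in> measurable M (PiM {..<j} (\<lambda>_. borel))"
    unfolding past_def using j by (intro measurable_restrict) auto
  note [measurable] = u(1) f(1) D_measurable[OF j]
  have ind: "indep_var (PiM {..<j} (\<lambda>_. borel)) past (PiM {j} (\<lambda>_. borel)) (\<lambda>\<omega>. restrict (\<lambda>i. D i \<omega>) {j})"
    unfolding past_def by (rule indep_var_restrict[OF indep]) (use j in auto)
  have ind': "indep_var borel (\<lambda>\<omega>. F (past \<omega>)) borel (\<lambda>\<omega>. G (D j \<omega>))"
    if [measurable]: "F \<in> borel_measurable (PiM {..<j} (\<lambda>_. borel))" "G \<in> borel_measurable borel"
    for F :: "(nat \<Rightarrow> 'a) \<Rightarrow> real" and G :: "'a \<Rightarrow> real"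
  proof -
    have m: "(\<lambda>x. G (x j)) \<in> borel_measurable (PiM {j} (\<lambda>_. borel))" by measurable
    show ?thesis using indep_var_compose[OF ind that(1) m] by (simp add: comp_def)
  qed
  have uint: "integrable M (\<lambda>\<omega>. u (past \<omega>))"
    by (rule integrable_const_bound[where B = 1]) (use u(2) in auto)
  let ?H = "\<lambda>x. u x *\<^sub>R f x"
  have H_int: "integrable M (\<lambda>\<omega>. ?H (past \<omega>) \<bullet> e)" for e
  proof (rule integrable_const_bound[where B = "b * norm e"])
    have "norm (?H x \<bullet> e) \<le> b * norm e" for x
      using Cauchy_Schwarz_ineq2[of "?H x" e] mult_right_mono[OF f(2)[of x] norm_ge_zero[of e]]
      unfolding real_norm_def by linarith
    then show "AE \<omega> in M. norm (?H (past \<omega>) \<bullet> e) \<le> b * norm e" by blast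
  qed auto
  have cross: "integrable M (\<lambda>\<omega>. (?H (past \<omega>) \<bullet> e) * (D j \<omega> \<bullet> e))"
    "expectation (\<lambda>\<omega>. (?H (past \<omega>) \<bullet> e) * (D j \<omega> \<bullet> e)) = 0" for e
  proof -
    have i: "indep_var borel (\<lambda>\<omega>. ?H (past \<omega>) \<bullet> e) borel (\<lambda>\<omega>. D j \<omega> \<bullet> e)"
      by (rule ind') auto
    have di: "integrable M (\<lambda>\<omega>. D j \<omega> \<bullet> e)" using D_integrable[OF j] by simp
    show "integrable M (\<lambda>\<omega>. (?H (past \<omega>) \<bullet> e) * (D j \<omega> \<bullet> e))"
      by (rule indep_var_integrable[OF i H_int di])
    show "expectation (\<lambda>\<omega>. (?H (past \<omega>) \<bullet> e) * (D j \<omega> \<bullet> e)) = 0"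
      unfolding indep_var_lebesgue_integral[OF i H_int di]
      using D_integrable[OF j] by (simp add: centred[OF j] integral_inner_left)
  qed
  have sq: "integrable M (\<lambda>\<omega>. u (past \<omega>) * (norm (D j \<omega>))\<^sup>2)"
    "expectation (\<lambda>\<omega>. u (past \<omega>) * (norm (D j \<omega>))\<^sup>2) = expectation (\<lambda>\<omega>. u (past \<omega>)) * v"
  proof -
    have i: "indep_var borel (\<lambda>\<omega>. u (past \<omega>)) borel (\<lambda>\<omega>. (norm (D j \<omega>))\<^sup>2)"
      by (rule ind') auto
    show "integrable M (\<lambda>\<omega>. u (past \<omega>) * (norm (D j \<omega>))\<^sup>2)"
      by (rule indep_var_integrable[OF i uint square_integrable[OF j]])
    show "expectation (\<lambda>\<omega>. u (past \<omega>) * (norm (D j \<omega>))\<^sup>2) = expectation (\<lambda>\<omega>. u (past \<omega>)) * v"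
      unfolding indep_var_lebesgue_integral[OF i uint square_integrable[OF j]] square[OF j] ..
  qed
  have g: "g = (\<lambda>\<omega>. (\<Sum>e\<in>Basis. 2 * ((?H (past \<omega>) \<bullet> e) * (D j \<omega> \<bullet> e))) + u (past \<omega>) * (norm (D j \<omega>))\<^sup>2)"
  proof
    fix \<omega>
    have "u (past \<omega>) * (D j \<omega> \<bullet> f (past \<omega>)) = ?H (past \<omega>) \<bullet> D j \<omega>" by (simp add: inner_commute)
    also have "\<dots> = (\<Sum>e\<in>Basis. (?H (past \<omega>) \<bullet> e) * (D j \<omega> \<bullet> e))"
      by (rule euclidean_inner)
    finally show "g \<omega> = (\<Sum>e\<in>Basis. 2 * ((?H (past \<omega>) \<bullet> e) * (D j \<omega> \<bullet> e))) + u (past \<omega>) * (norm (D j \<omega>))\<^sup>2"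
      by (simp add: g_def algebra_simps flip: sum_distrib_left)
  qed
  show "integrable M g"
    unfolding g by (intro Bochner_Integration.integrable_add Bochner_Integration.integrable_sum integrable_mult_right cross sq)
  show "expectation g = v * expectation (\<lambda>\<omega>. u (past \<omega>))"
    unfolding g using cross sq
    by (subst Bochner_Integration.integral_add) (auto intro!: Bochner_Integration.integrable_sum)
qed

abbreviation position :: "'w \<Rightarrow> nat \<Rightarrow> 'a" where
  "position \<omega> \<equiv> walk (\<lambda>j. D j \<omega>)"

lemma walk_measurable:
  "i \<le> j \<Longrightarrow> (\<lambda>x. walk x i) \<in> borel_measurable (PiM {..<j} (\<lambda>_. borel :: 'a measure))"
  unfolding walk_def by (intro borel_measurable_sum measurable_component_singleton) auto

lemma greedy_measurable:
  assumes "i \<le> j"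
  shows "(\<lambda>x. greedy_center (walk x) i) \<in> borel_measurable (PiM {..<j} (\<lambda>_. borel :: 'a measure))
    \<and> (\<lambda>x. greedy_radius (walk x) i) \<in> borel_measurable (PiM {..<j} (\<lambda>_. borel :: 'a measure))"
  using assms
proof (induction i)
  case (Suc i)
  let ?c = "\<lambda>x. greedy_center (walk x) i" and ?r = "\<lambda>x. greedy_radius (walk x) i"
  have "?c \<in> borel_measurable (PiM {..<j} (\<lambda>_. borel :: 'a measure))"
    "?r \<in> borel_measurable (PiM {..<j} (\<lambda>_. borel :: 'a measure))"
    using Suc.IH Suc.prems by simp_all
  from enlarge_measurable[OF this walk_measurable[OF Suc.prems]]
  show ?case by (simp only: greedy_ball.simps prod.collapse)
qed simp

text \<open>Optional stopping in summed form. The events \<open>u j\<close> say that the walk has not been stopped before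
  step \<open>j\<close>, so the sum of their probabilities is the expected number of steps, truncated at \<open>k\<close>.
  Adaptedness is expressed by invariance under restriction to the first \<open>j\<close> steps, which allows
  \<open>u j\<close> and \<open>f j\<close> to be applied to the whole sequence.\<close>

lemma stopped_sum_expectation:
  fixes u :: "nat \<Rightarrow> (nat \<Rightarrow> 'a) \<Rightarrow> bool" and f :: "nat \<Rightarrow> (nat \<Rightarrow> 'a) \<Rightarrow> 'a"
  assumes u: "\<And>j. j < k \<Longrightarrow> Measurable.pred (PiM {..<j} (\<lambda>_. borel)) (u j)"
    and f: "\<And>j. j < k \<Longrightarrow> f j \<in> borel_measurable (PiM {..<j} (\<lambda>_. borel))"
    and b: "\<And>j x. u j x \<Longrightarrow> norm (f j x) \<le> b"
    and adapted: "\<And>j x. u j (restrict x {..<j}) = u j x" "\<And>j x. f j (restrict x {..<j}) = f j x"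
  defines "d \<equiv> \<lambda>\<omega> j. D j \<omega>"
  defines "S \<equiv> \<lambda>\<omega>. \<Sum>j<k. of_bool (u j (d \<omega>)) * (2 * (d \<omega> j \<bullet> f j (d \<omega>)) + (norm (d \<omega> j))\<^sup>2)"
  shows "integrable M S" "expectation S = v * (\<Sum>j<k. prob {\<omega> \<in> space M. u j (d \<omega>)})"
    and "j < k \<Longrightarrow> {\<omega> \<in> space M. u j (d \<omega>)} \<in> events"
proof -
  have S: "S = (\<lambda>\<omega>. \<Sum>j<k. of_bool (u j (restrict (\<lambda>i. D i \<omega>) {..<j})) *
    (2 * (D j \<omega> \<bullet> f j (restrict (\<lambda>i. D i \<omega>) {..<j})) + (norm (D j \<omega>))\<^sup>2))"
    unfolding S_def d_def by (simp add: adapted)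
  have step: "integrable M (\<lambda>\<omega>. of_bool (u j (restrict (\<lambda>i. D i \<omega>) {..<j})) *
      (2 * (D j \<omega> \<bullet> f j (restrict (\<lambda>i. D i \<omega>) {..<j})) + (norm (D j \<omega>))\<^sup>2))"
    "expectation (\<lambda>\<omega>. of_bool (u j (restrict (\<lambda>i. D i \<omega>) {..<j})) *
      (2 * (D j \<omega> \<bullet> f j (restrict (\<lambda>i. D i \<omega>) {..<j})) + (norm (D j \<omega>))\<^sup>2))
     = v * prob {\<omega> \<in> space M. u j (d \<omega>)}"
    "{\<omega> \<in> space M. u j (d \<omega>)} \<in> events"
    if j: "j < k" for j
  proof -
    have past: "(\<lambda>\<omega>. restrict (\<lambda>i. D i \<omega>) {..<j}) \<in> measurable M (PiM {..<j} (\<lambda>_. borel))"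
      using j by (intro measurable_restrict) auto
    show ev: "{\<omega> \<in> space M. u j (d \<omega>)} \<in> events"
      using measurable_compose[OF past u[OF j]] unfolding d_def pred_def by (simp add: adapted)
    have um: "(\<lambda>x. of_bool (u j x) :: real) \<in> borel_measurable (PiM {..<j} (\<lambda>_. borel))"
      using u[OF j] by measurable
    have bd: "norm ((of_bool (u j x) :: real) *\<^sub>R f j x) \<le> max b 0" for x
      using b[of j x] by (cases "u j x") (auto simp: le_max_iff_disj)
    note P = predictable_step[OF j um _ f[OF j] bd]
    show "integrable M (\<lambda>\<omega>. of_bool (u j (restrict (\<lambda>i. D i \<omega>) {..<j})) *
      (2 * (D j \<omega> \<bullet> f j (restrict (\<lambda>i. D i \<omega>) {..<j})) + (norm (D j \<omega>))\<^sup>2))"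
      by (rule P) auto
    have "expectation (\<lambda>\<omega>. of_bool (u j (restrict (\<lambda>i. D i \<omega>) {..<j}))) = prob {\<omega> \<in> space M. u j (d \<omega>)}"
      unfolding adapted using ev
      by (subst Bochner_Integration.integral_cong[where N = M and g = "indicator {\<omega> \<in> space M. u j (d \<omega>)}"])
         (auto simp: d_def)
    then show "expectation (\<lambda>\<omega>. of_bool (u j (restrict (\<lambda>i. D i \<omega>) {..<j})) *
      (2 * (D j \<omega> \<bullet> f j (restrict (\<lambda>i. D i \<omega>) {..<j})) + (norm (D j \<omega>))\<^sup>2))
      = v * prob {\<omega> \<in> space M. u j (d \<omega>)}"
      by (subst P(2)) auto
  qed
  show "integrable M S" unfolding S by (intro Bochner_Integration.integrable_sum step) auto
  show "expectation S = v * (\<Sum>j<k. prob {\<omega> \<in> space M. u j (d \<omega>)})"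
    unfolding S by (subst Bochner_Integration.integral_sum) (auto simp: step sum_distrib_left)
  show "j < k \<Longrightarrow> {\<omega> \<in> space M. u j (d \<omega>)} \<in> events" by (rule step)
qed

text \<open>Taking expectations in the pathwise bound for the greedy ball gives
  \<open>2 * (1 - p) \<le> v * (\<Sum>j<k. prob (A j))\<close>, where \<open>p\<close> is the probability of \<open>A (k - 1)\<close>. As the events
  \<open>A j\<close> decrease, \<open>p\<close> is at most the average of their probabilities, which yields the correction
  \<open>2 / k\<close>.\<close>

lemma greedy_radius_prob:
  assumes k: "0 < k"
  defines "A \<equiv> \<lambda>j. {\<omega> \<in> space M. greedy_radius (position \<omega>) j \<le> 1}"
  shows "2 \<le> (v + 2 / k) * (\<Sum>j<k. prob (A j))"
    and "\<And>j. j < k \<Longrightarrow> A j \<in> events"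
proof -
  define u where "u j x \<longleftrightarrow> greedy_radius (walk x) j \<le> 1" for j and x :: "nat \<Rightarrow> 'a"
  define f where "f j x = walk x j - greedy_center (walk x) j" for j and x :: "nat \<Rightarrow> 'a"
  have gr: "greedy_ball (walk (restrict x {..<j})) j = greedy_ball (walk x) j" for j and x :: "nat \<Rightarrow> 'a"
    by (rule greedy_ball_cong) (rule walk_restrict)
  have A: "A j = {\<omega> \<in> space M. u j (\<lambda>j. D j \<omega>)}" for j by (simp add: A_def u_def)
  have [measurable]: "(\<lambda>x. greedy_center (walk x) j) \<in> borel_measurable (PiM {..<j} (\<lambda>_. borel :: 'a measure))"
    "(\<lambda>x. greedy_radius (walk x) j) \<in> borel_measurable (PiM {..<j} (\<lambda>_. borel :: 'a measure))"
    "(\<lambda>x. walk x j) \<in> borel_measurable (PiM {..<j} (\<lambda>_. borel :: 'a measure))" for j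
    using greedy_measurable[of j j] walk_measurable[of j j] by auto
  have um: "Measurable.pred (PiM {..<j} (\<lambda>_. borel)) (u j)" for j unfolding u_def by measurable
  have fm: "f j \<in> borel_measurable (PiM {..<j} (\<lambda>_. borel))" for j unfolding f_def by measurable
  have b: "norm (f j x) \<le> 1" if "u j x" for j x
    using greedy_ball_covers[of j j "walk x"] that unfolding u_def f_def
    by (simp add: dist_norm norm_minus_commute)
  have ad: "u j (restrict x {..<j}) = u j x" "f j (restrict x {..<j}) = f j x" for j x
    unfolding u_def f_def by (simp_all add: gr walk_restrict)
  note E = stopped_sum_expectation[of u f 1, OF um fm b ad]
  let ?S = "\<lambda>\<omega>. \<Sum>j<k. of_bool (u j (\<lambda>j. D j \<omega>)) * (2 * (D j \<omega> \<bullet> f j (\<lambda>j. D j \<omega>)) + (norm (D j \<omega>))\<^sup>2)"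
  have um': "{\<omega> \<in> space M. u (k - 1) (\<lambda>j. D j \<omega>)} \<in> events"
    using E(3)[of "k - 1"] k by simp
  have pw: "2 * (1 - indicator (A (k - 1)) \<omega>) \<le> ?S \<omega>" if "\<omega> \<in> space M" for \<omega>
  proof -
    have "2 * of_bool (\<not> u (k - 1) (\<lambda>j. D j \<omega>)) \<le> (2::real) * of_bool (\<not> u k (\<lambda>j. D j \<omega>))"
      using greedy_radius_mono[of "k - 1" k "position \<omega>"] by (auto simp: u_def simp del: greedy_ball.simps)
    also have "\<dots> \<le> ?S \<omega>"
      using greedy_stopped_sum[of "\<lambda>j. D j \<omega>" k] unfolding u_def f_def .
    finally show ?thesis using that by (auto simp: A indicator_def)
  qed
  have Ak: "A (k - 1) \<in> events" using um' by (simp add: A)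
  then have iA: "integrable M (indicator (A (k - 1)) :: 'w \<Rightarrow> real)"
    by (intro integrable_const_bound[where B = 1]) auto
  with Ak have "2 * (1 - prob (A (k - 1))) = expectation (\<lambda>\<omega>. 2 * (1 - indicator (A (k - 1)) \<omega>))"
    by (subst integral_mult_right_zero, subst Bochner_Integration.integral_diff)
       (auto simp: prob_space)
  also have "\<dots> \<le> expectation ?S"
    using iA by (intro integral_mono E(1) pw) auto
  also have "\<dots> = v * (\<Sum>j<k. prob (A j))" unfolding A using E(2) .
  finally have 1: "2 \<le> v * (\<Sum>j<k. prob (A j)) + 2 * prob (A (k - 1))" by simp
  have "k * prob (A (k - 1)) = (\<Sum>j<k. prob (A (k - 1)))" by simp
  also have "\<dots> \<le> (\<Sum>j<k. prob (A j))"
  proof (intro sum_mono finite_measure_mono)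
    fix j assume j: "j \<in> {..<k}"
    show "A j \<in> events" using E(3)[of j] j by (simp add: A)
    show "A (k - 1) \<subseteq> A j"
    proof
      fix \<omega> assume "\<omega> \<in> A (k - 1)"
      moreover have "greedy_radius (position \<omega>) j \<le> greedy_radius (position \<omega>) (k - 1)"
        by (rule greedy_radius_mono) (use j in auto)
      ultimately show "\<omega> \<in> A j" unfolding A_def by auto
    qed
  qed
  finally have "prob (A (k - 1)) \<le> (\<Sum>j<k. prob (A j)) / k" using k by (simp add: field_simps)
  then show "2 \<le> (v + 2 / k) * (\<Sum>j<k. prob (A j))" using 1 by (simp add: algebra_simps)
  show "j < k \<Longrightarrow> A j \<in> events" for j using E(3)[of j] by (simp add: A)
qed

lemma exit_prob:
  assumes \<delta>: "0 < \<delta>" "\<delta> \<le> 1"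
  defines "A \<equiv> \<lambda>j. {\<omega> \<in> space M. \<forall>i\<le>j. norm (position \<omega> i) \<le> 2}"
  shows "v * (\<Sum>j<k. prob (A j)) \<le> 4 + 5 * \<delta> + 5 / \<delta> ^ 3 * (k * q)"
    and "\<And>j. j < k \<Longrightarrow> A j \<in> events"
proof -
  define u where "u j x \<longleftrightarrow> (\<forall>i\<le>j. norm (walk x i) \<le> 2)" for j and x :: "nat \<Rightarrow> 'a"
  have A: "A j = {\<omega> \<in> space M. u j (\<lambda>j. D j \<omega>)}" for j by (simp add: A_def u_def)
  have wm: "(\<lambda>x. walk x i) \<in> borel_measurable (PiM {..<j} (\<lambda>_. borel :: 'a measure))"
    if "i \<le> j" for i j using walk_measurable[OF that] .
  have um: "Measurable.pred (PiM {..<j} (\<lambda>_. borel)) (u j)" for j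
  proof -
    have [measurable]: "Measurable.pred (PiM {..<j} (\<lambda>_. borel)) (\<lambda>x. norm (walk x i :: 'a) \<le> 2)" if "i \<in> {..j}" for i
      using wm[of i j] that by simp
    have "u j = (\<lambda>x. \<forall>i\<in>{..j}. norm (walk x i) \<le> 2)" by (auto simp: u_def fun_eq_iff)
    then show ?thesis by simp measurable
  qed
  define f where "f j x = walk x j" for j and x :: "nat \<Rightarrow> 'a"
  have fm: "f j \<in> borel_measurable (PiM {..<j} (\<lambda>_. borel))" for j
    using wm[of j j] unfolding f_def by simp
  have b: "norm (f j x) \<le> 2" if "u j x" for j x using that by (simp add: u_def f_def)
  have ad: "u j (restrict x {..<j}) = u j x" "f j (restrict x {..<j}) = f j x" for j x
    by (simp_all add: u_def f_def walk_restrict)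
  note E = stopped_sum_expectation[of u f 2, OF um fm b ad]
  let ?S = "\<lambda>\<omega>. \<Sum>j<k. of_bool (u j (\<lambda>j. D j \<omega>)) * (2 * (D j \<omega> \<bullet> position \<omega> j) + (norm (D j \<omega>))\<^sup>2)"
  have S: "integrable M ?S" "expectation ?S = v * (\<Sum>j<k. prob (A j))"
    unfolding A using E(1,2) by (simp_all only: f_def)
  have Z: "integrable M (\<lambda>\<omega>. \<Sum>j<k. norm (D j \<omega>) ^ 4)"
    by (intro Bochner_Integration.integrable_sum fourth_integrable) auto
  have "v * (\<Sum>j<k. prob (A j)) = expectation ?S" using S by simp
  also have "\<dots> \<le> expectation (\<lambda>\<omega>. 4 + 5 * \<delta> + 5 / \<delta> ^ 3 * (\<Sum>j<k. norm (D j \<omega>) ^ 4))"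
    using S(1) Z exit_stopped_sum[OF \<delta>, of "\<lambda>j. D j \<omega>" k for \<omega>]
    by (intro integral_mono) (auto simp: u_def)
  also have "\<dots> = 4 + 5 * \<delta> + 5 / \<delta> ^ 3 * (\<Sum>j<k. expectation (\<lambda>\<omega>. norm (D j \<omega>) ^ 4))"
    using Z fourth_integrable by (simp add: prob_space Bochner_Integration.integral_sum)
  also have "\<dots> \<le> 4 + 5 * \<delta> + 5 / \<delta> ^ 3 * (\<Sum>j<k. q)"
    using \<delta> fourth by (intro add_left_mono mult_left_mono sum_mono) auto
  finally show "v * (\<Sum>j<k. prob (A j)) \<le> 4 + 5 * \<delta> + 5 / \<delta> ^ 3 * (k * q)" by simp
  show "A j \<in> events" if "j < k" for j
    unfolding A by (rule E(3)[OF _ that])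
qed

end

section \<open>Brownian increments on a regular time grid\<close>

text \<open>Independence over the times within one coordinate and independence of the coordinate processes
  combine to joint independence over all pairs of a time step and a coordinate. It suffices to factor the
  probability of a finite intersection: over the coordinates, as the event for one coordinate
  is a measurable condition on its whole path, and then over the time steps.\<close>

lemma coordinate_increments_indep:
  fixes W :: "real \<Rightarrow> 'w \<Rightarrow> real ^ 'n" and h :: real
  assumes W: "standard_brownian_motion M W" and h: "0 < h" and N: "0 < N"
  shows "prob_space.indep_vars M (\<lambda>_. borel)
    (\<lambda>(j, i) \<omega>. W (real (Suc j) * h) \<omega> $ i - W (real j * h) \<omega> $ i) ({..<N} \<times> UNIV)"
proof -
  interpret prob_space M using W by (simp add: standard_brownian_motion_def)
  define X where "X = (\<lambda>(j, i) \<omega>. W (real (Suc j) * h) \<omega> $ i - W (real j * h) \<omega> $ i)"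
  have one: "standard_brownian_motion_1d M (\<lambda>t \<omega>. W t \<omega> $ i)" for i
    using W by (simp add: standard_brownian_motion_def)
  have time: "indep_vars (\<lambda>_. borel) (\<lambda>j. X (j, i)) {..<N}" for i
  proof -
    have st: "\<And>(k::nat) (\<tau>::nat \<Rightarrow> real). 0 \<le> \<tau> 0 \<Longrightarrow> (\<forall>i<k. \<tau> i < \<tau> (Suc i)) \<Longrightarrow>
        indep_vars (\<lambda>_. borel) (\<lambda>j \<omega>. W (\<tau> (Suc j)) \<omega> $ i - W (\<tau> j) \<omega> $ i) {..<k}"
      using one[of i] by (simp add: standard_brownian_motion_1d_def)
    show ?thesis unfolding X_def prod.case
      by (rule st[of "\<lambda>j. real j * h"]) (use h in auto)
  qed
  have Xm [measurable]: "X (j, i) \<in> borel_measurable M" if "j < N" for i j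
    using time[of i] that by (auto simp: indep_vars_def)
  define incr where "incr = (\<lambda>(x :: real \<Rightarrow> real). \<lambda>j\<in>{..<N}. x (real (Suc j) * h) - x (real j * h))"
  have incr: "incr \<in> measurable (PiM {0..} (\<lambda>_. borel)) (PiM {..<N} (\<lambda>_. borel))"
    unfolding incr_def using h
    by (intro measurable_restrict borel_measurable_diff measurable_component_singleton) auto
  define V where "V i = (\<lambda>\<omega>. \<lambda>j\<in>{..<N}. X (j, i) \<omega>)" for i
  have V: "V i = (\<lambda>\<omega>. incr (\<lambda>t\<in>{0..}. W t \<omega> $ i))" for i
    using h unfolding V_def incr_def X_def by (auto simp: fun_eq_iff restrict_def)
  have space: "indep_vars (\<lambda>_. PiM {..<N} (\<lambda>_. borel)) V UNIV"
    unfolding V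
    by (rule indep_vars_compose2[OF _ incr])
       (use W in \<open>simp add: standard_brownian_motion_def\<close>)
  have "indep_vars (\<lambda>_. borel) X ({..<N} \<times> UNIV) \<longleftrightarrow>
    (\<forall>A\<in>(\<Pi> p\<in>{..<N} \<times> UNIV. sets borel). prob (\<Inter>p\<in>{..<N} \<times> UNIV. X p -` A p \<inter> space M)
      = (\<Prod>p\<in>{..<N} \<times> UNIV. prob (X p -` A p \<inter> space M)))"
    using N by (intro indep_vars_finite) (auto simp: sets.sigma_sets_eq[of borel, simplified] sets.Int_stable intro: Xm)
  moreover have "prob (\<Inter>p\<in>{..<N} \<times> UNIV. X p -` A p \<inter> space M)
      = (\<Prod>p\<in>{..<N} \<times> UNIV. prob (X p -` A p \<inter> space M))"
    if A: "A \<in> (\<Pi> p\<in>{..<N} \<times> UNIV. sets borel)" for A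
  proof -
    have Am: "A (j, i) \<in> sets borel" if "j < N" for i j using A that by auto
    have VA: "V i -` (\<Pi>\<^sub>E j\<in>{..<N}. A (j, i)) \<inter> space M = (\<Inter>j\<in>{..<N}. X (j, i) -` A (j, i) \<inter> space M)" for i
      using N by (auto simp: V_def PiE_iff)
    have "(\<Inter>p\<in>{..<N} \<times> UNIV. X p -` A p \<inter> space M)
      = (\<Inter>i\<in>UNIV. V i -` (\<Pi>\<^sub>E j\<in>{..<N}. A (j, i)) \<inter> space M)"
      unfolding VA by auto
    also have "prob \<dots> = (\<Prod>i\<in>UNIV. prob (V i -` (\<Pi>\<^sub>E j\<in>{..<N}. A (j, i)) \<inter> space M))"
      by (rule indep_varsD[OF space]) (auto intro!: sets_PiM_I_finite Am)
    also have "\<dots> = (\<Prod>i\<in>UNIV. \<Prod>j\<in>{..<N}. prob (X (j, i) -` A (j, i) \<inter> space M))"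
      unfolding VA by (intro prod.cong refl indep_varsD[OF time]) (use N Am in auto)
    also have "\<dots> = (\<Prod>p\<in>{..<N} \<times> UNIV. prob (X p -` A p \<inter> space M))"
      by (subst prod.swap) (simp add: prod.cartesian_product split_def)
    finally show ?thesis .
  qed
  ultimately show ?thesis unfolding X_def by blast
qed

text \<open>Grouping the jointly independent scalar increments by time step.\<close>

lemma vector_increments_indep:
  fixes W :: "real \<Rightarrow> 'w \<Rightarrow> real ^ 'n" and h :: real
  assumes W: "standard_brownian_motion M W" and h: "0 < h" and N: "0 < N"
  shows "prob_space.indep_vars M (\<lambda>_. borel)
    (\<lambda>j \<omega>. W (real (Suc j) * h) \<omega> - W (real j * h) \<omega>) {..<N}"
proof -
  interpret prob_space M using W by (simp add: standard_brownian_motion_def)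
  define X where "X = (\<lambda>(j, i) \<omega>. W (real (Suc j) * h) \<omega> $ i - W (real j * h) \<omega> $ i)"
  have "indep_vars (\<lambda>j. PiM ({j} \<times> UNIV) (\<lambda>_. borel))
      (\<lambda>j \<omega>. restrict (\<lambda>p. X p \<omega>) ({j} \<times> UNIV)) {..<N}"
    by (rule indep_vars_restrict[OF coordinate_increments_indep[OF assms, folded X_def]])
       (auto simp: disjoint_family_on_def)
  moreover have "(\<lambda>x. (\<chi> i. x (j, i)) :: real ^ 'n) \<in> borel_measurable (PiM ({j} \<times> UNIV) (\<lambda>_. borel))" for j :: nat
    unfolding borel_measurable_euclidean_space[where 'c = "real ^ 'n"]
    by (auto simp: Basis_vec_def inner_axis)
  ultimately have "indep_vars (\<lambda>_. borel)
      (\<lambda>j \<omega>. (\<chi> i. restrict (\<lambda>p. X p \<omega>) ({j} \<times> UNIV) (j, i)) :: real ^ 'n) {..<N}"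
    by (rule indep_vars_compose2)
  then show ?thesis
    by (rule indep_vars_cong[THEN iffD1, rotated -1]) (auto simp: X_def vec_eq_iff)
qed

lemma (in prob_space) centred_normal_moments:
  assumes X: "distributed M lborel X (normal_density 0 (sqrt h))" and h: "0 < h"
  shows "integrable M X" "expectation X = 0"
    "integrable M (\<lambda>\<omega>. X \<omega> ^ 2)" "expectation (\<lambda>\<omega>. X \<omega> ^ 2) = h"
    "integrable M (\<lambda>\<omega>. X \<omega> ^ 4)" "expectation (\<lambda>\<omega>. X \<omega> ^ 4) = 3 * h\<^sup>2"
proof -
  have int: "integrable M (\<lambda>\<omega>. X \<omega> ^ m)" for m
    using distributed_integrable[OF X, of "\<lambda>x. x ^ m"] integrable_normal_moment[of "sqrt h" 0 m] h by simp
  have ex: "expectation (\<lambda>\<omega>. X \<omega> ^ m) = (\<integral>x. normal_density 0 (sqrt h) x * x ^ m \<partial>lborel)" for m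
    using distributed_integral[OF X, of "\<lambda>x. x ^ m"] by simp
  show "integrable M X" "integrable M (\<lambda>\<omega>. X \<omega> ^ 2)" "integrable M (\<lambda>\<omega>. X \<omega> ^ 4)"
    using int[of 1] int[of 2] int[of 4] by simp_all
  show "expectation X = 0" using ex[of 1] integral_normal_moment_odd[of "sqrt h" 0 0] h by simp
  show "expectation (\<lambda>\<omega>. X \<omega> ^ 2) = h"
    using ex[of 2] integral_normal_moment_even[of "sqrt h" 0 1] h by (simp add: fact_numeral)
  show "expectation (\<lambda>\<omega>. X \<omega> ^ 4) = 3 * h\<^sup>2"
    using ex[of 4] integral_normal_moment_even[of "sqrt h" 0 2] h
    by (simp add: fact_numeral power2_eq_square)
qed

lemma norm_square_vec: "(norm x)\<^sup>2 = (\<Sum>i\<in>UNIV. (x $ i)\<^sup>2)" for x :: "real ^ 'n"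
  unfolding power2_norm_eq_inner inner_vec_def by (simp add: power2_eq_square)

lemma norm_fourth_vec: "norm x ^ 4 \<le> CARD('n) * (\<Sum>i\<in>UNIV. (x $ i) ^ 4)" for x :: "real ^ 'n"
proof -
  have "norm x ^ 4 = (\<Sum>i\<in>UNIV. (x $ i)\<^sup>2)\<^sup>2"
    unfolding norm_square_vec[symmetric] by simp
  also have "\<dots> \<le> (\<Sum>i\<in>UNIV. ((x $ i)\<^sup>2)\<^sup>2) * CARD('n)"
    by (rule sum_squared_le_sum_of_squares) 
  finally show ?thesis by (simp add: mult.commute)
qed

lemma brownian_increments_centred_steps:
  fixes W :: "real \<Rightarrow> 'w \<Rightarrow> real ^ 'n" and h :: real
  assumes W: "standard_brownian_motion M W" and h: "0 < h" and N: "0 < N"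
  shows "centred_steps M (\<lambda>j \<omega>. W (real (Suc j) * h) \<omega> - W (real j * h) \<omega>) N
    (CARD('n) * h) (3 * (CARD('n) * h)\<^sup>2)"
proof -
  interpret prob_space M using W by (simp add: standard_brownian_motion_def)
  let ?D = "\<lambda>j \<omega>. W (real (Suc j) * h) \<omega> - W (real j * h) \<omega>"
  have ind: "indep_vars (\<lambda>_. borel) ?D {..<N}" by (rule vector_increments_indep[OF assms])
  then have Dm [measurable]: "?D j \<in> borel_measurable M" if "j < N" for j
    using that by (auto simp: indep_vars_def)
  have "distributed M lborel (\<lambda>\<omega>. ?D j \<omega> $ i) (normal_density 0 (sqrt h))" for i j
  proof -
    have st: "\<And>s t. 0 \<le> s \<Longrightarrow> s < t \<Longrightarrow>
        distributed M lborel (\<lambda>\<omega>. W t \<omega> $ i - W s \<omega> $ i) (normal_density 0 (sqrt (t - s)))"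
      using W by (simp add: standard_brownian_motion_def standard_brownian_motion_1d_def)
    show ?thesis using st[of "real j * h" "real (Suc j) * h"] h by (simp add: algebra_simps)
  qed
  note mom = centred_normal_moments[OF this h]
  show ?thesis
  proof
    fix j assume j: "j < N"
    have D: "?D j = (\<lambda>\<omega>. \<Sum>i\<in>UNIV. (?D j \<omega> $ i) *\<^sub>R axis i 1)"
      using basis_expansion[of "?D j \<omega>" for \<omega>] by (simp add: fun_eq_iff scalar_mult_eq_scaleR)
    show "expectation (?D j) = 0"
      by (subst D, subst Bochner_Integration.integral_sum) (use mom in auto)
    show "expectation (\<lambda>\<omega>. (norm (?D j \<omega>))\<^sup>2) = CARD('n) * h"
      unfolding norm_square_vec by (subst Bochner_Integration.integral_sum) (use mom in auto)
    have four: "integrable M (\<lambda>\<omega>. CARD('n) * (\<Sum>i\<in>UNIV. (?D j \<omega> $ i) ^ 4))"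
      using mom by (intro integrable_mult_right Bochner_Integration.integrable_sum) auto
    show "integrable M (\<lambda>\<omega>. norm (?D j \<omega>) ^ 4)"
    proof (rule Bochner_Integration.integrable_bound[OF four])
      have "norm (norm x ^ 4) \<le> norm (CARD('n) * (\<Sum>i\<in>UNIV. (x $ i) ^ 4))" for x :: "real ^ 'n"
        using order_trans[OF norm_fourth_vec[of x] abs_ge_self] by simp
      then show "AE \<omega> in M. norm (norm (?D j \<omega>) ^ 4) \<le> norm (CARD('n) * (\<Sum>i\<in>UNIV. (?D j \<omega> $ i) ^ 4))"
        by (intro AE_I2)
    qed (use Dm[OF j] in measurable)
    then have "expectation (\<lambda>\<omega>. norm (?D j \<omega>) ^ 4) \<le> expectation (\<lambda>\<omega>. CARD('n) * (\<Sum>i\<in>UNIV. (?D j \<omega> $ i) ^ 4))"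
      using four by (intro integral_mono norm_fourth_vec)
    also have "\<dots> = CARD('n) * (\<Sum>i\<in>(UNIV :: 'n set). 3 * h\<^sup>2)"
      by (subst integral_mult_right_zero, subst Bochner_Integration.integral_sum) (use mom in auto)
    also have "\<dots> = 3 * (CARD('n) * h)\<^sup>2" by (simp add: power2_eq_square)
    finally show "expectation (\<lambda>\<omega>. norm (?D j \<omega>) ^ 4) \<le> 3 * (CARD('n) * h)\<^sup>2" .
  qed (rule ind)
qed

section \<open>The inverse circumradius and the discretised exit times\<close>

context
  fixes W :: "real \<Rightarrow> 'w \<Rightarrow> real ^ 'n" and \<omega> :: 'w
  assumes cont: "continuous_on {0..} (\<lambda>t. W t \<omega>)" and start: "W 0 \<omega> = 0"
begin

lemma path_image_subset_hull: "0 \<le> s \<Longrightarrow> s \<le> t \<Longrightarrow> W s \<omega> \<in> path_hull W t \<omega>"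
  unfolding path_hull_def by (rule hull_inc) auto

lemma bounded_path_hull: "bounded (path_hull W t \<omega>)"
  unfolding path_hull_def
  by (intro bounded_convex_hull compact_imp_bounded compact_continuous_image continuous_on_subset[OF cont]) auto

lemma circumradius_path_hull_gt_1:
  assumes "0 \<le> t" "2 < norm (W t \<omega>)"
  shows "1 < circumradius (path_hull W t \<omega>)"
proof -
  have in_hull: "0 \<in> path_hull W t \<omega>" "W t \<omega> \<in> path_hull W t \<omega>"
    using path_image_subset_hull[of 0 t] path_image_subset_hull[of t t] assms start by auto
  obtain c where "path_hull W t \<omega> \<subseteq> cball c (circumradius (path_hull W t \<omega>))"
    using circumradius_attained(2)[OF bounded_path_hull] in_hull by blast
  with in_hull have "norm c \<le> circumradius (path_hull W t \<omega>)" "dist c (W t \<omega>) \<le> circumradius (path_hull W t \<omega>)"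
    by auto
  then show ?thesis using assms(2) norm_triangle_ineq2[of "W t \<omega>" c] by (simp add: dist_norm norm_minus_commute)
qed

text \<open>The right-hand side is the first grid time at which the path is outside the ball of radius \<open>2\<close>,
  truncated at \<open>N * h\<close>, because the summands equal to \<open>1\<close> count the grid times strictly before it. At
  that time two points of the hull, the origin and the position, are more than \<open>2\<close> apart.\<close>

lemma inverse_circumradius_le_exit:
  fixes h :: real and N :: nat
  assumes h: "0 < h"
  shows "min (inverse_circumradius W 1 \<omega>) (ennreal (N * h))
    \<le> ennreal (h * (\<Sum>j<N. of_bool (\<forall>i\<le>j. norm (W (real i * h) \<omega>) \<le> 2)))"
proof (cases "\<exists>i<N. 2 < norm (W (real i * h) \<omega>)")
  case False
  have "(\<Sum>j<N. of_bool (\<forall>i\<le>j. norm (W (real i * h) \<omega>) \<le> 2)) = (\<Sum>j<N. 1::real)"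
  proof (rule sum.cong)
    fix j assume "j \<in> {..<N}"
    then have "\<forall>i\<le>j. norm (W (real i * h) \<omega>) \<le> 2" using False by (meson lessThan_iff not_less order_le_less_trans)
    then show "of_bool (\<forall>i\<le>j. norm (W (real i * h) \<omega>) \<le> 2) = (1::real)" by simp
  qed simp
  then show ?thesis by (simp add: min_le_iff_disj mult.commute)
next
  case True
  define i0 where "i0 = (LEAST i. i < N \<and> 2 < norm (W (real i * h) \<omega>))"
  have i0: "i0 < N" "2 < norm (W (real i0 * h) \<omega>)"
    using LeastI_ex[OF True] by (auto simp: i0_def)
  have before: "norm (W (real i * h) \<omega>) \<le> 2" if "i < i0" for i
    using not_less_Least[of i "\<lambda>i. i < N \<and> 2 < norm (W (real i * h) \<omega>)"] that i0(1) by (auto simp: i0_def)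
  have "inverse_circumradius W 1 \<omega> \<le> ennreal (i0 * h)"
    unfolding inverse_circumradius_def
    using circumradius_path_hull_gt_1[of "real i0 * h"] i0 h by (intro INF_lower) auto
  also have "real i0 = (\<Sum>j<i0. of_bool (\<forall>i\<le>j. norm (W (real i * h) \<omega>) \<le> 2))"
  proof -
    have "(\<Sum>j<i0. of_bool (\<forall>i\<le>j. norm (W (real i * h) \<omega>) \<le> 2)) = (\<Sum>j<i0. 1::real)"
      by (rule sum.cong) (auto simp: before)
    then show ?thesis by simp
  qed
  also have "\<dots> * h \<le> (\<Sum>j<N. of_bool (\<forall>i\<le>j. norm (W (real i * h) \<omega>) \<le> 2)) * h"
    using i0 h by (intro mult_right_mono sum_mono2) auto
  finally have "inverse_circumradius W 1 \<omega> \<le> ennreal (h * (\<Sum>j<N. of_bool (\<forall>i\<le>j. norm (W (real i * h) \<omega>) \<le> 2)))"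
    using h by (simp add: mult.commute ennreal_leI)
  then show ?thesis by (simp add: min_le_iff_disj)
qed

text \<open>If the grid points up to time \<open>t\<close> lie in a ball of radius \<open>1\<close>, uniform continuity puts the whole path
  up to time \<open>t\<close>, and hence its convex hull, in a concentric ball of radius barely above \<open>1\<close>. On fine
  grids this contradicts a circumradius strictly above \<open>1\<close>.\<close>

lemma eventually_greedy_radius_gt_1:
  assumes t: "0 \<le> t" "1 < circumradius (path_hull W t \<omega>)"
  obtains \<delta> where "0 < \<delta>"
    "\<And>h. 0 < h \<Longrightarrow> h < \<delta> \<Longrightarrow> 1 < greedy_radius (\<lambda>i. W (real i * h) \<omega>) (nat \<lfloor>t / h\<rfloor>)"
proof -
  define e where "e = (circumradius (path_hull W t \<omega>) - 1) / 2"
  have e: "0 < e" "1 + e < circumradius (path_hull W t \<omega>)" using t(2) by (auto simp: e_def field_simps)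
  have "uniformly_continuous_on {0..t} (\<lambda>s. W s \<omega>)"
    by (intro compact_uniformly_continuous continuous_on_subset[OF cont]) auto
  then obtain \<delta> where \<delta>: "0 < \<delta>"
    "\<And>s s'. s \<in> {0..t} \<Longrightarrow> s' \<in> {0..t} \<Longrightarrow> dist s' s < \<delta> \<Longrightarrow> dist (W s' \<omega>) (W s \<omega>) < e"
    using e(1) unfolding uniformly_continuous_on_def by metis
  show thesis
  proof (rule that[OF \<delta>(1)], rule ccontr)
    fix h :: real assume h: "0 < h" "h < \<delta>"
    let ?J = "nat \<lfloor>t / h\<rfloor>"
    define c where "c = greedy_center (\<lambda>i. W (real i * h) \<omega>) ?J"
    assume "\<not> 1 < greedy_radius (\<lambda>i. W (real i * h) \<omega>) ?J"
    then have grid: "dist c (W (real i * h) \<omega>) \<le> 1" if "i \<le> ?J" for i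
      using greedy_ball_covers[OF that, of "\<lambda>i. W (real i * h) \<omega>"] by (simp add: c_def)
    have "W s \<omega> \<in> cball c (1 + e)" if s: "s \<in> {0..t}" for s
    proof -
      define i where "i = nat \<lfloor>s / h\<rfloor>"
      have "real i = of_int \<lfloor>s / h\<rfloor>" using s h by (simp add: i_def)
      then have "real i \<le> s / h" "s / h < real i + 1" by linarith+
      then have i: "real i * h \<le> s" "s < real i * h + h" using h by (simp_all add: field_simps)
      have "i \<le> ?J" unfolding i_def using s h by (intro nat_mono floor_mono divide_right_mono) auto
      moreover have "dist (W (real i * h) \<omega>) (W s \<omega>) < e"
        using i s h by (intro \<delta>(2)) (auto simp: dist_real_def)
      ultimately show ?thesis
        using grid[of i] dist_triangle[of c "W s \<omega>" "W (real i * h) \<omega>"] by simp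
    qed
    then have "path_hull W t \<omega> \<subseteq> cball c (1 + e)"
      unfolding path_hull_def by (intro hull_minimal) auto
    then have "circumradius (path_hull W t \<omega>) \<le> 1 + e"
      using circumradius_attained(3)[OF bounded_path_hull] path_image_subset_hull[of 0 t] t(1) by blast
    then show False using e(2) by simp
  qed
qed

text \<open>On fine grids the greedy radius exceeds \<open>1\<close> no later than any time at which the hull has circumradius
  above \<open>1\<close>. No monotonicity in the grid is available, because the greedy ball depends on the order
  in which the points arrive; hence an upper limit.\<close>

lemma limsup_greedy_le_inverse_circumradius:
  fixes h :: "nat \<Rightarrow> real" and N :: "nat \<Rightarrow> nat"
  assumes h: "\<And>m. 0 < h m" "h \<longlonglongrightarrow> 0"
  shows "limsup (\<lambda>m. ennreal (h m * (\<Sum>j<N m. of_bool (greedy_radius (\<lambda>i. W (real i * h m) \<omega>) j \<le> 1))))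
    \<le> inverse_circumradius W 1 \<omega>"
  unfolding inverse_circumradius_def
proof (rule INF_greatest)
  fix t assume "t \<in> {t. 0 \<le> t \<and> circumradius (path_hull W t \<omega>) > 1}"
  then have t: "0 \<le> t" "1 < circumradius (path_hull W t \<omega>)" by auto
  then obtain \<delta> where \<delta>: "0 < \<delta>"
    "\<And>h. 0 < h \<Longrightarrow> h < \<delta> \<Longrightarrow> 1 < greedy_radius (\<lambda>i. W (real i * h) \<omega>) (nat \<lfloor>t / h\<rfloor>)"
    using eventually_greedy_radius_gt_1 by metis
  show "limsup (\<lambda>m. ennreal (h m * (\<Sum>j<N m. of_bool (greedy_radius (\<lambda>i. W (real i * h m) \<omega>) j \<le> 1)))) \<le> ennreal t"
  proof (rule Limsup_bounded, rule eventually_mono[OF order_tendstoD(2)[OF h(2) \<delta>(1)]])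
    fix m assume m: "h m < \<delta>"
    let ?J = "nat \<lfloor>t / h m\<rfloor>" and ?r = "greedy_radius (\<lambda>i. W (real i * h m) \<omega>)"
    have "(\<Sum>j<N m. of_bool (?r j \<le> 1)) \<le> (\<Sum>j<N m. of_bool (j < ?J) :: real)"
    proof (rule sum_mono)
      fix j
      have "1 < ?r ?J" using \<delta>(2)[OF h(1) m] .
      then show "of_bool (?r j \<le> 1) \<le> (of_bool (j < ?J) :: real)"
        using greedy_radius_mono[of ?J j "\<lambda>i. W (real i * h m) \<omega>"] by (cases "j < ?J") auto
    qed
    also have "\<dots> = real (card ({..<N m} \<inter> {j. j < ?J}))" by simp
    also have "\<dots> \<le> real ?J"
      using card_mono[of "{..<?J}" "{..<N m} \<inter> {j. j < ?J}"] by auto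
    also have "real ?J \<le> t / h m" using t(1) h(1)[of m] by simp
    finally show "ennreal (h m * (\<Sum>j<N m. of_bool (?r j \<le> 1))) \<le> ennreal t"
      using h(1)[of m] by (intro ennreal_leI) (simp add: field_simps)
  qed
qed

end

text \<open>Finitely many coordinates share a single null set.\<close>

lemma brownian_path_regular:
  fixes W :: "real \<Rightarrow> 'w \<Rightarrow> real ^ 'n"
  assumes "standard_brownian_motion M W"
  shows "AE \<omega> in M. continuous_on {0..} (\<lambda>t. W t \<omega>) \<and> W 0 \<omega> = 0"
proof -
  have "AE \<omega> in M. \<forall>i. continuous_on {0..} (\<lambda>t. W t \<omega> $ i) \<and> W 0 \<omega> $ i = 0"
    using assms unfolding standard_brownian_motion_def standard_brownian_motion_1d_def
    by (subst AE_all_countable) auto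
  then show ?thesis
  proof eventually_elim
    case (elim \<omega>)
    then have "continuous_on {0..} (\<lambda>t. \<chi> i. W t \<omega> $ i)" by (intro continuous_on_vec_lambda) auto
    then show ?case using elim by (simp add: vec_eq_iff)
  qed
qed

lemma (in prob_space) nn_integral_scaled_count:
  assumes h: "0 \<le> (h::real)" and ev: "\<And>j. j < N \<Longrightarrow> {\<omega> \<in> space M. P j \<omega>} \<in> events"
  shows "(\<integral>\<^sup>+\<omega>. ennreal (h * (\<Sum>j<N. of_bool (P j \<omega>))) \<partial>M) = ennreal (h * (\<Sum>j<N. prob {\<omega> \<in> space M. P j \<omega>}))"
    and "(\<lambda>\<omega>. ennreal (h * (\<Sum>j<N. of_bool (P j \<omega>)))) \<in> borel_measurable M"
proof -
  have eq: "ennreal (h * (\<Sum>j<N. of_bool (P j \<omega>)))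
      = ennreal (h * (\<Sum>j<N. indicator {\<omega> \<in> space M. P j \<omega>} \<omega>))" if "\<omega> \<in> space M" for \<omega>
    using that by (simp add: indicator_def of_bool_def)
  have int: "integrable M (indicator {\<omega> \<in> space M. P j \<omega>} :: 'a \<Rightarrow> real)" if "j < N" for j
    using ev[OF that] by (intro integrable_const_bound[where B = 1]) auto
  have "(\<integral>\<^sup>+\<omega>. ennreal (h * (\<Sum>j<N. of_bool (P j \<omega>))) \<partial>M)
    = (\<integral>\<^sup>+\<omega>. ennreal (h * (\<Sum>j<N. indicator {\<omega> \<in> space M. P j \<omega>} \<omega>)) \<partial>M)"
    by (rule nn_integral_cong) (rule eq)
  also have "\<dots> = ennreal (expectation (\<lambda>\<omega>. h * (\<Sum>j<N. indicator {\<omega> \<in> space M. P j \<omega>} \<omega>)))"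
    using h int by (intro nn_integral_eq_integral integrable_mult_right Bochner_Integration.integrable_sum)
      (auto intro!: mult_nonneg_nonneg sum_nonneg)
  also have "expectation (\<lambda>\<omega>. h * (\<Sum>j<N. indicator {\<omega> \<in> space M. P j \<omega>} \<omega>))
      = h * (\<Sum>j<N. expectation (indicator {\<omega> \<in> space M. P j \<omega>}))"
    using int by (subst integral_mult_right_zero, subst Bochner_Integration.integral_sum) auto
  also have "\<dots> = h * (\<Sum>j<N. prob {\<omega> \<in> space M. P j \<omega>})"
    using ev by simp
  finally show "(\<integral>\<^sup>+\<omega>. ennreal (h * (\<Sum>j<N. of_bool (P j \<omega>))) \<partial>M) = ennreal (h * (\<Sum>j<N. prob {\<omega> \<in> space M. P j \<omega>}))" .
  have "(\<lambda>\<omega>. ennreal (h * (\<Sum>j<N. indicator {\<omega> \<in> space M. P j \<omega>} \<omega>))) \<in> borel_measurable M"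
    using ev by (intro measurable_compose[OF _ measurable_ennreal] borel_measurable_times borel_measurable_sum) auto
  then show "(\<lambda>\<omega>. ennreal (h * (\<Sum>j<N. of_bool (P j \<omega>)))) \<in> borel_measurable M"
    by (rule measurable_cong[THEN iffD2, rotated]) (rule eq)
qed

section \<open>Expected inverse circumradius\<close>

lemma walk_increments: "walk (\<lambda>j. p (real (Suc j) * h) - p (real j * h)) i = p (real i * h) - p 0"
  for p :: "real \<Rightarrow> 'a::real_inner"
  unfolding walk_def by (subst sum_lessThan_telescope) simp

text \<open>In dimension \<open>n\<close> the exit estimate bounds \<open>n\<close> times the mean truncated exit time by \<open>4\<close> plus an
  overshoot error. Grid width, horizon and overshoot threshold all vary with one index \<open>m\<close>, so that
  a single application of Fatou's lemma removes the truncation and the error.\<close>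

lemma expected_inverse_circumradius_upper:
  fixes W :: "real \<Rightarrow> 'w \<Rightarrow> real ^ 'n"
  assumes W: "standard_brownian_motion M W"
  shows "(\<integral>\<^sup>+ \<omega>. inverse_circumradius W 1 \<omega> \<partial>M) \<le> ennreal (4 / CARD('n))"
proof -
  interpret prob_space M using W by (simp add: standard_brownian_motion_def)
  define n where "n = real CARD('n)"
  have n: "0 < n" by (simp add: n_def)
  \<comment> \<open>Horizon \<open>N m * h m = m\<close>, overshoot threshold \<open>1 / 2 ^ m\<close>. The width \<open>h m\<close> is the fourth power of the
    threshold, which leaves a fourth-moment error of order \<open>m / 2 ^ m\<close>.\<close>
  define h :: "nat \<Rightarrow> real" where "h m = 1 / 16 ^ m" for m
  define N where "N m = m * 16 ^ m" for m :: nat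
  have h: "0 < h m" for m by (simp add: h_def)
  have N: "0 < N m" if "0 < m" for m using that by (simp add: N_def)
  define d where "d m = (\<lambda>\<omega> j. W (real (Suc j) * h m) \<omega> - W (real j * h m) \<omega>)" for m
  define P where "P m j \<omega> \<longleftrightarrow> (\<forall>i\<le>j. norm (walk (d m \<omega>) i) \<le> 2)" for m j \<omega>
  define u where "u m \<omega> = ennreal (h m * (\<Sum>j<N m. of_bool (P m j \<omega>)))" for m \<omega>
  define b where "b m = (4 + 5 / 2 ^ m + 15 * n\<^sup>2 * (m / 2 ^ m)) / n" for m :: nat
  have u: "u m \<in> borel_measurable M" "(\<integral>\<^sup>+\<omega>. u m \<omega> \<partial>M) \<le> ennreal (b m)" if m: "0 < m" for m
  proof -
    interpret centred_steps M "\<lambda>j \<omega>. d m \<omega> j" "N m" "n * h m" "3 * (n * h m)\<^sup>2"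
      unfolding d_def n_def by (rule brownian_increments_centred_steps[OF W h N[OF m]])
    have ev: "{\<omega> \<in> space M. P m j \<omega>} \<in> events" if "j < N m" for j
      unfolding P_def by (rule exit_prob(2)[of 1, OF _ _ that]) simp_all
    have "n * h m * (\<Sum>j<N m. prob {\<omega> \<in> space M. P m j \<omega>})
        \<le> 4 + 5 * (1 / 2 ^ m) + 5 / (1 / 2 ^ m) ^ 3 * (N m * (3 * (n * h m)\<^sup>2))"
      unfolding P_def by (rule exit_prob(1)) (auto simp: field_simps)
    also have "5 / (1 / 2 ^ m) ^ 3 * (N m * (3 * (n * h m)\<^sup>2)) = 15 * n\<^sup>2 * (m / 2 ^ m)"
    proof -
      define x :: real where "x = 2 ^ m"
      have x: "0 < x" "16 ^ m = x ^ 4"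
        using power_mult[of "2 :: real" m 4] power_mult[of "2 :: real" 4 m] by (simp_all add: x_def mult.commute)
      have "5 / (1 / x) ^ 3 * (real m * x ^ 4 * (3 * (n * (1 / x ^ 4))\<^sup>2)) = 15 * n\<^sup>2 * (m / x)"
        using x(1) by (simp add: field_simps eval_nat_numeral)
      then show ?thesis by (simp only: N_def h_def of_nat_mult of_nat_power of_nat_numeral x(2) flip: x_def)
    qed
    finally have "h m * (\<Sum>j<N m. prob {\<omega> \<in> space M. P m j \<omega>}) \<le> b m"
      using n by (simp add: b_def field_simps)
    then show "(\<integral>\<^sup>+\<omega>. u m \<omega> \<partial>M) \<le> ennreal (b m)"
      unfolding u_def by (subst nn_integral_scaled_count(1)[OF less_imp_le[OF h] ev]) (auto intro: ennreal_leI)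
    show "u m \<in> borel_measurable M"
      unfolding u_def by (rule nn_integral_scaled_count(2)[OF less_imp_le[OF h] ev])
  qed
  have "AE \<omega> in M. inverse_circumradius W 1 \<omega> \<le> liminf (\<lambda>m. u (Suc m) \<omega>)"
    using brownian_path_regular[OF W]
  proof eventually_elim
    case (elim \<omega>)
    have "P m j \<omega> \<longleftrightarrow> (\<forall>i\<le>j. norm (W (real i * h m) \<omega>) \<le> 2)" for m j
      using elim walk_increments[of "\<lambda>t. W t \<omega>" "h m"] by (simp add: P_def d_def)
    then have "min (inverse_circumradius W 1 \<omega>) (ennreal (N m * h m)) \<le> u m \<omega>" for m
      using inverse_circumradius_le_exit[of W \<omega> "h m" "N m"] elim h by (simp add: u_def)
    moreover have "N m * h m = m" for m by (simp add: N_def h_def)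
    ultimately have le: "min (inverse_circumradius W 1 \<omega>) (of_nat m) \<le> u m \<omega>" for m
      by (simp add: ennreal_of_nat_eq_real_of_nat)
    show ?case
      unfolding le_Liminf_iff
    proof (intro allI impI)
      fix y assume y: "y < inverse_circumradius W 1 \<omega>"
      have "y < top" by (rule less_le_trans[OF y top_greatest])
      then obtain m0 :: nat where m0: "y < of_nat m0" using ennreal_Ex_less_of_nat by blast
      show "\<forall>\<^sub>F m in sequentially. y < u (Suc m) \<omega>"
        using eventually_ge_at_top[of m0]
      proof eventually_elim
        case (elim m)
        have "of_nat m0 \<le> (of_nat (Suc m) :: ennreal)" using elim by (intro of_nat_mono) simp
        then have "y < min (inverse_circumradius W 1 \<omega>) (of_nat (Suc m))"
          using y less_le_trans[OF m0] by simp
        then show ?case by (rule less_le_trans[OF _ le])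
      qed
    qed
  qed
  then have "(\<integral>\<^sup>+ \<omega>. inverse_circumradius W 1 \<omega> \<partial>M) \<le> (\<integral>\<^sup>+ \<omega>. liminf (\<lambda>m. u (Suc m) \<omega>) \<partial>M)"
    by (rule nn_integral_mono_AE)
  also have "\<dots> \<le> liminf (\<lambda>m. \<integral>\<^sup>+ \<omega>. u (Suc m) \<omega> \<partial>M)"
    by (rule nn_integral_liminf) (simp add: u)
  also have "\<dots> \<le> liminf (\<lambda>m. ennreal (b (Suc m)))"
    by (intro Liminf_mono always_eventually allI u) simp
  also have "\<dots> = ennreal (4 / n)"
  proof (rule lim_imp_Liminf)
    have "(\<lambda>m. real m / 2 ^ m) \<longlonglongrightarrow> 0"
      using powser_times_n_limit_0[of "1 / 2 :: real"] by (simp add: power_divide)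
    moreover have "(\<lambda>m. 5 / 2 ^ m :: real) \<longlonglongrightarrow> 0"
      by (rule LIMSEQ_divide_realpow_zero) simp
    ultimately have "b \<longlonglongrightarrow> (4 + 0 + 15 * n\<^sup>2 * 0) / n"
      unfolding b_def using n by (intro tendsto_intros) auto
    then show "(\<lambda>m. ennreal (b (Suc m))) \<longlonglongrightarrow> ennreal (4 / n)"
      by (intro tendsto_ennrealI LIMSEQ_Suc) simp
  qed simp
  finally show ?thesis by (simp add: n_def)
qed

text \<open>The horizon \<open>K\<close> provides the constant dominating function needed to exchange the upper limit with the
  integral.\<close>

lemma expected_inverse_circumradius_lower_truncated:
  fixes W :: "real \<Rightarrow> 'w \<Rightarrow> real ^ 'n"
  assumes W: "standard_brownian_motion M W" and K: "0 < (K::nat)"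
  shows "ennreal (2 / (CARD('n) + 2 / K)) \<le> (\<integral>\<^sup>+ \<omega>. inverse_circumradius W 1 \<omega> \<partial>M)"
proof -
  interpret prob_space M using W by (simp add: standard_brownian_motion_def)
  define n where "n = real CARD('n)"
  have n: "0 < n" by (simp add: n_def)
  \<comment> \<open>The grid is refined while the horizon \<open>N m * h m = K\<close> stays fixed, so that \<open>K\<close> dominates all truncated
    times.\<close>
  define h :: "nat \<Rightarrow> real" where "h m = inverse (real (Suc m))" for m
  define N where "N m = K * Suc m" for m :: nat
  have h: "0 < h m" for m by (simp add: h_def)
  have Nh: "N m * h m = K" and N: "0 < N m" for m using K by (simp_all add: N_def h_def field_simps)
  define d where "d m = (\<lambda>\<omega> j. W (real (Suc j) * h m) \<omega> - W (real j * h m) \<omega>)" for m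
  define P where "P m j \<omega> \<longleftrightarrow> greedy_radius (walk (d m \<omega>)) j \<le> 1" for m j \<omega>
  define u where "u m \<omega> = ennreal (h m * (\<Sum>j<N m. of_bool (P m j \<omega>)))" for m \<omega>
  have u: "u m \<in> borel_measurable M" "ennreal (2 / (n + 2 / K)) \<le> (\<integral>\<^sup>+\<omega>. u m \<omega> \<partial>M)" for m
  proof -
    interpret centred_steps M "\<lambda>j \<omega>. d m \<omega> j" "N m" "n * h m" "3 * (n * h m)\<^sup>2"
      unfolding d_def n_def by (rule brownian_increments_centred_steps[OF W h N])
    have ev: "{\<omega> \<in> space M. P m j \<omega>} \<in> events" if "j < N m" for j
      unfolding P_def by (rule greedy_radius_prob(2)[OF N that])
    have "2 \<le> (n * h m + 2 / N m) * (\<Sum>j<N m. prob {\<omega> \<in> space M. P m j \<omega>})"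
      unfolding P_def by (rule greedy_radius_prob(1)[OF N])
    also have "2 / N m = 2 / K * h m"
      using Nh[of m] N[of m] K by (simp add: field_simps)
    also have "(n * h m + 2 / K * h m) * (\<Sum>j<N m. prob {\<omega> \<in> space M. P m j \<omega>})
        = (n + 2 / K) * (h m * (\<Sum>j<N m. prob {\<omega> \<in> space M. P m j \<omega>}))"
      by (simp add: algebra_simps)
    finally have "2 / (n + 2 / K) \<le> h m * (\<Sum>j<N m. prob {\<omega> \<in> space M. P m j \<omega>})"
      using n by (subst pos_divide_le_eq) (auto simp: mult.commute add_pos_nonneg)
    then show "ennreal (2 / (n + 2 / K)) \<le> (\<integral>\<^sup>+\<omega>. u m \<omega> \<partial>M)"
      unfolding u_def by (subst nn_integral_scaled_count(1)[OF less_imp_le[OF h] ev]) (auto intro: ennreal_leI)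
    show "u m \<in> borel_measurable M"
      unfolding u_def by (rule nn_integral_scaled_count(2)[OF less_imp_le[OF h] ev])
  qed
  have bound: "u m \<omega> \<le> ennreal K" for m \<omega>
  proof -
    have "(\<Sum>j<N m. of_bool (P m j \<omega>)) \<le> (\<Sum>j<N m. 1::real)" by (rule sum_mono) auto
    then have "h m * (\<Sum>j<N m. of_bool (P m j \<omega>)) \<le> h m * N m"
      using h[of m] by (intro mult_left_mono) auto
    then show ?thesis unfolding u_def using Nh[of m] by (intro ennreal_leI) (simp add: mult.commute)
  qed
  have "ennreal (2 / (n + 2 / K)) \<le> limsup (\<lambda>m. \<integral>\<^sup>+\<omega>. u m \<omega> \<partial>M)"
    using u(2) by (intro order_trans[OF _ Liminf_le_Limsup] Liminf_bounded) auto
  also have "\<dots> \<le> (\<integral>\<^sup>+\<omega>. limsup (\<lambda>m. u m \<omega>) \<partial>M)"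
    by (rule nn_integral_limsup[where w = "\<lambda>_. ennreal K"]) (use u(1) bound emeasure_space_1 in auto)
  also have "\<dots> \<le> (\<integral>\<^sup>+ \<omega>. inverse_circumradius W 1 \<omega> \<partial>M)"
  proof (rule nn_integral_mono_AE)
    have h0: "h \<longlonglongrightarrow> 0" unfolding h_def by (rule LIMSEQ_inverse_real_of_nat)
    show "AE \<omega> in M. limsup (\<lambda>m. u m \<omega>) \<le> inverse_circumradius W 1 \<omega>"
      using brownian_path_regular[OF W]
    proof eventually_elim
      case (elim \<omega>)
      have "walk (d m \<omega>) = (\<lambda>i. W (real i * h m) \<omega>)" for m
        using elim walk_increments[of "\<lambda>t. W t \<omega>" "h m"] by (simp add: d_def fun_eq_iff)
      then show ?case
        using limsup_greedy_le_inverse_circumradius[of W \<omega> h N] elim h h0 by (simp add: u_def P_def)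
    qed
  qed
  finally show ?thesis by (simp add: n_def)
qed

lemma expected_inverse_circumradius_lower:
  fixes W :: "real \<Rightarrow> 'w \<Rightarrow> real ^ 'n"
  assumes W: "standard_brownian_motion M W"
  shows "ennreal (2 / CARD('n)) \<le> (\<integral>\<^sup>+ \<omega>. inverse_circumradius W 1 \<omega> \<partial>M)"
proof (rule LIMSEQ_le_const2)
  have "(\<lambda>K. 2 / (real CARD('n) + 2 * inverse (real (Suc K)))) \<longlonglongrightarrow> 2 / (real CARD('n) + 2 * 0)"
    by (intro tendsto_intros LIMSEQ_inverse_real_of_nat) simp
  then show "(\<lambda>K. ennreal (2 / (CARD('n) + 2 / real (Suc K)))) \<longlonglongrightarrow> ennreal (2 / CARD('n))"
    by (intro tendsto_ennrealI) (simp add: divide_inverse)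
  show "\<exists>K0. \<forall>K\<ge>K0. ennreal (2 / (CARD('n) + 2 / real (Suc K)))
      \<le> (\<integral>\<^sup>+ \<omega>. inverse_circumradius W 1 \<omega> \<partial>M)"
    by (intro exI[of _ 0] allI impI expected_inverse_circumradius_lower_truncated[OF W]) simp
qed

theorem theorem6:
  fixes M :: "'w measure" and W :: "real \<Rightarrow> 'w \<Rightarrow> real ^ 'n"
  assumes "standard_brownian_motion M W"
  shows "ennreal (1 / ln 2 * (1 / real CARD('n))) \<le> (\<integral>\<^sup>+ \<omega>. inverse_circumradius W 1 \<omega> \<partial>M)
    \<and> (\<integral>\<^sup>+ \<omega>. inverse_circumradius W 1 \<omega> \<partial>M) \<le> ennreal (4 * (1 / real CARD('n)))"
proof
  have "1 / ln 2 \<le> (2 :: real)"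
    using ln2_ge_two_thirds by (simp add: field_simps)
  then have "1 / ln 2 * (1 / real CARD('n)) \<le> 2 * (1 / real CARD('n))"
    by (rule mult_right_mono) simp
  then have "ennreal (1 / ln 2 * (1 / real CARD('n))) \<le> ennreal (2 / real CARD('n))"
    by (intro ennreal_leI) simp
  also have "\<dots> \<le> (\<integral>\<^sup>+ \<omega>. inverse_circumradius W 1 \<omega> \<partial>M)"
    by (rule expected_inverse_circumradius_lower[OF assms])
  finally show "ennreal (1 / ln 2 * (1 / real CARD('n))) \<le> (\<integral>\<^sup>+ \<omega>. inverse_circumradius W 1 \<omega> \<partial>M)" .
  show "(\<integral>\<^sup>+ \<omega>. inverse_circumradius W 1 \<omega> \<partial>M) \<le> ennreal (4 * (1 / real CARD('n)))"
    using expected_inverse_circumradius_upper[OF assms] by simp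
qed

end
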